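(* Let $\beta\ge0$ be real, let $\mathfrak g=\mathfrak g_{3,5}$ be the three-dimensional real Lie algebra with basis $e_1,e_2,e_3$ and nonzero brackets $[e_1,e_3]=\beta e_1-e_2$, $[e_2,e_3]=e_1+\beta e_2$, and let $(\mathfrak g,\nabla)$ be a flat Lie algebra. Then $(\mathfrak g,\nabla)$ is isomorphic to exactly one of the following flat Lie algebras (only nonzero products $e_ie_j=\nabla_{e_i}e_j$ are listed): $\mathfrak h_{0,1}$: $e_3e_1=-\beta e_1+e_2,\ e_3e_2=-e_1-\beta e_2,\ e_3e_3=\lambda e_3$; $\lambda\in\mathbb R$. $\mathfrak h_{0,2}$: $e_1e_3=\lambda e_1,\ e_2e_3=\lambda e_2,\ e_3e_1=(\lambda-\beta)e_1+e_2,\ e_3e_2=-e_1+(\lambda-\beta)e_2,\ e_3e_3=\lambda e_3$; $\lambda\in\mathbb R\setminus\{0\}$. $\mathfrak h_{0,3}$: $e_1e_1=\varepsilon e_3,\ e_2e_2=\varepsilon e_3,\ e_3e_1=-\beta e_1+e_2,\ e_3e_2=-e_1-\beta e_2,\ e_3e_3=-2\beta e_3$; $\varepsilon=\pm1$.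
   Context: A connection on a real Lie algebra $\mathfrak g$ is a bilinear map $\nabla:\mathfrak g\times\mathfrak g\to\mathfrak g$, $(X,Y)\mapsto\nabla_XY$. It is torsion-free if $\nabla_XY-\nabla_YX=[X,Y]$ for all $X,Y$, and flat if $\nabla_X\nabla_YZ-\nabla_Y\nabla_XZ-\nabla_{[X,Y]}Z=0$ for all $X,Y,Z$. A flat Lie algebra is a pair $(\mathfrak g,\nabla)$ with $\nabla$ a flat, torsion-free connection on $\mathfrak g$. Two flat torsion-free connections $\nabla^1,\nabla^2$ on $\mathfrak g$ are isomorphic if there is a Lie algebra automorphism $\Psi$ of $\mathfrak g$ with $\nabla^2_X=\Psi\circ\nabla^1_{\Psi^{-1}(X)}\circ\Psi^{-1}$ for all $X\in\mathfrak g$. Each admissible choice of the parameters gives a flat Lie algebra of the list.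
   Formalization: For β=0 the swap e1↔e2, e3→−e3 is an automorphism identifying parameters λ and −λ (ε and −ε), so "exactly one" fails; proved instead: exactly one family for all β≥0, a unique parameter for β>0, and for β=0 a parameter unique exactly up to sign. *)

theory Defs
  imports "HOL-Analysis.Analysis"
begin

definition lie_bracket :: "('a::real_vector \<Rightarrow> 'a \<Rightarrow> 'a) \<Rightarrow> bool" where
  "lie_bracket br \<longleftrightarrow> bilinear br \<and> (\<forall>X. br X X = 0) \<and>
     (\<forall>X Y Z. br X (br Y Z) + br Y (br Z X) + br Z (br X Y) = 0)"

definition torsion_free ::
  "('a::real_vector \<Rightarrow> 'a \<Rightarrow> 'a) \<Rightarrow> ('a \<Rightarrow> 'a \<Rightarrow> 'a) \<Rightarrow> bool" where
  "torsion_free br nabla \<longleftrightarrow> (\<forall>X Y. nabla X Y - nabla Y X = br X Y)"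

definition flat_connection ::
  "('a::real_vector \<Rightarrow> 'a \<Rightarrow> 'a) \<Rightarrow> ('a \<Rightarrow> 'a \<Rightarrow> 'a) \<Rightarrow> bool" where
  "flat_connection br nabla \<longleftrightarrow>
     (\<forall>X Y Z. nabla X (nabla Y Z) - nabla Y (nabla X Z) - nabla (br X Y) Z = 0)"

definition flat_lie_algebra ::
  "('a::real_vector \<Rightarrow> 'a \<Rightarrow> 'a) \<Rightarrow> ('a \<Rightarrow> 'a \<Rightarrow> 'a) \<Rightarrow> bool" where
  "flat_lie_algebra br nabla \<longleftrightarrow>
     lie_bracket br \<and> bilinear nabla \<and> torsion_free br nabla \<and> flat_connection br nabla"

definition lie_automorphism ::
  "('a::real_vector \<Rightarrow> 'a \<Rightarrow> 'a) \<Rightarrow> ('a \<Rightarrow> 'a) \<Rightarrow> bool" where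
  "lie_automorphism br \<Psi> \<longleftrightarrow>
     linear \<Psi> \<and> bij \<Psi> \<and> (\<forall>X Y. \<Psi> (br X Y) = br (\<Psi> X) (\<Psi> Y))"

definition isomorphic_connections ::
  "('a::real_vector \<Rightarrow> 'a \<Rightarrow> 'a) \<Rightarrow> ('a \<Rightarrow> 'a \<Rightarrow> 'a) \<Rightarrow> ('a \<Rightarrow> 'a \<Rightarrow> 'a) \<Rightarrow> bool" where
  "isomorphic_connections br nabla1 nabla2 \<longleftrightarrow>
     (\<exists>\<Psi>. lie_automorphism br \<Psi> \<and>
        (\<forall>X. nabla2 X = \<Psi> \<circ> nabla1 (inv \<Psi> X) \<circ> inv \<Psi>))"

abbreviation e1 :: "real^3" where "e1 \<equiv> axis 1 1"
abbreviation e2 :: "real^3" where "e2 \<equiv> axis 2 1"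
abbreviation e3 :: "real^3" where "e3 \<equiv> axis 3 1"

text \<open>The bilinear map sending the \<open>i\<close>-th and \<open>j\<close>-th standard basis vectors to \<open>c (i, j)\<close>.
  The tables \<open>c\<close> below are updates of the zero table, so products not listed vanish.\<close>

definition bilinear_of_table :: "(3 \<times> 3 \<Rightarrow> real^3) \<Rightarrow> real^3 \<Rightarrow> real^3 \<Rightarrow> real^3" where
  "bilinear_of_table c X Y = (\<Sum>i\<in>UNIV. \<Sum>j\<in>UNIV. (X $ i * Y $ j) *\<^sub>R c (i, j))"

definition g35 :: "real \<Rightarrow> real^3 \<Rightarrow> real^3 \<Rightarrow> real^3" where
  "g35 \<beta> = bilinear_of_table ((\<lambda>_. 0)(
     (1,3) := \<beta> *\<^sub>R e1 - e2,
     (3,1) := - (\<beta> *\<^sub>R e1 - e2),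
     (2,3) := e1 + \<beta> *\<^sub>R e2,
     (3,2) := - (e1 + \<beta> *\<^sub>R e2)))"

datatype h_family = H01 | H02 | H03

fun h_params :: "h_family \<Rightarrow> real set" where
  "h_params H01 = UNIV"
| "h_params H02 = UNIV - {0}"
| "h_params H03 = {1, -1}"

fun h_conn :: "real \<Rightarrow> h_family \<Rightarrow> real \<Rightarrow> real^3 \<Rightarrow> real^3 \<Rightarrow> real^3" where
  "h_conn \<beta> H01 l = bilinear_of_table ((\<lambda>_. 0)(
     (3,1) := (-\<beta>) *\<^sub>R e1 + e2,
     (3,2) := - e1 - \<beta> *\<^sub>R e2,
     (3,3) := l *\<^sub>R e3))"
| "h_conn \<beta> H02 l = bilinear_of_table ((\<lambda>_. 0)(
     (1,3) := l *\<^sub>R e1,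
     (2,3) := l *\<^sub>R e2,
     (3,1) := (l - \<beta>) *\<^sub>R e1 + e2,
     (3,2) := - e1 + (l - \<beta>) *\<^sub>R e2,
     (3,3) := l *\<^sub>R e3))"
| "h_conn \<beta> H03 \<epsilon> = bilinear_of_table ((\<lambda>_. 0)(
     (1,1) := \<epsilon> *\<^sub>R e3,
     (2,2) := \<epsilon> *\<^sub>R e3,
     (3,1) := (-\<beta>) *\<^sub>R e1 + e2,
     (3,2) := - e1 - \<beta> *\<^sub>R e2,
     (3,3) := (-2 * \<beta>) *\<^sub>R e3))"

lemma bilinear_of_table_bilinear: "bilinear (bilinear_of_table c)"
  unfolding bilinear_def bilinear_of_table_def
  by (intro conjI allI linearI)
     (simp_all add: algebra_simps sum.distrib scaleR_sum_right)

lemma g35_lie_bracket: "lie_bracket (g35 \<beta>)"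
  unfolding lie_bracket_def
proof (intro conjI allI)
  show "bilinear (g35 \<beta>)" by (simp add: g35_def bilinear_of_table_bilinear)
qed (simp_all add: g35_def bilinear_of_table_def vec_eq_iff forall_3 sum_3 axis_def algebra_simps)

lemma h_conn_flat: "flat_lie_algebra (g35 \<beta>) (h_conn \<beta> k s)"
  unfolding flat_lie_algebra_def
proof (intro conjI)
  show "bilinear (h_conn \<beta> k s)" by (cases k) (simp_all add: bilinear_of_table_bilinear)
  show "torsion_free (g35 \<beta>) (h_conn \<beta> k s)"
    unfolding torsion_free_def
    by (cases k) (simp_all add: g35_def bilinear_of_table_def vec_eq_iff forall_3 sum_3 axis_def algebra_simps)
  show "flat_connection (g35 \<beta>) (h_conn \<beta> k s)"
    unfolding flat_connection_def
    by (cases k) (simp_all add: g35_def bilinear_of_table_def vec_eq_iff forall_3 sum_3 axis_def algebra_simps)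
qed (rule g35_lie_bracket)

text \<open>For \<open>\<beta> = 0\<close> the automorphism swapping \<open>e1\<close> and \<open>e2\<close> and negating \<open>e3\<close>
  reverses the sign of the parameter in each family, so there the parameter can
  at best be unique up to sign.\<close>

lemma h_conn_sign_flip: "isomorphic_connections (g35 0) (h_conn 0 k s) (h_conn 0 k (- s))"
proof -
  define \<Psi> :: "real^3 \<Rightarrow> real^3" where "\<Psi> X = vector [X $ 2, X $ 1, - (X $ 3)]" for X
  have inv2: "\<Psi> (\<Psi> X) = X" for X
    by (simp add: \<Psi>_def vec_eq_iff forall_3)
  have "inv \<Psi> = \<Psi>" by (rule inv_unique_comp) (simp_all add: fun_eq_iff inv2)
  moreover have "bij \<Psi>" by (rule bijI') (metis inv2)+
  moreover have "linear \<Psi>"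
    by (rule linearI) (simp_all add: \<Psi>_def vec_eq_iff forall_3)
  moreover have "\<Psi> (g35 0 X Y) = g35 0 (\<Psi> X) (\<Psi> Y)" for X Y
    by (simp add: \<Psi>_def g35_def bilinear_of_table_def vec_eq_iff forall_3 sum_3 axis_def algebra_simps)
  moreover have "h_conn 0 k (- s) X Y = \<Psi> (h_conn 0 k s (\<Psi> X) (\<Psi> Y))" for X Y
    by (cases k) (simp_all add: \<Psi>_def bilinear_of_table_def vec_eq_iff forall_3 sum_3 axis_def algebra_simps)
  ultimately show ?thesis
    unfolding isomorphic_connections_def lie_automorphism_def
    by (intro exI[of _ \<Psi>]) (simp add: fun_eq_iff)
qed

end

theory Submission
  imports Defs "HOL-Computational_Algebra.Fundamental_Theorem_Algebra"
begin

text \<open>Write \<open>L\<^sub>i\<close> for the left multiplication by \<open>e\<^sub>i\<close>. Over the complex numbers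
  \<open>N = L\<^sub>1 + \<i> L\<^sub>2\<close> and \<open>N' = L\<^sub>1 - \<i> L\<^sub>2\<close> commute and shift the eigenvalues of \<open>L\<^sub>3\<close> by
  \<open>-(\<beta> \<plusminus> \<i>)\<close>, so starting from an eigenvector of \<open>L\<^sub>3\<close> one reaches a common kernel vector \<open>k\<close>
  of \<open>L\<^sub>1\<close> and \<open>L\<^sub>2\<close>. An automorphism moves \<open>k\<close> to \<open>e\<^sub>1\<close> or to \<open>e\<^sub>3\<close>. In the first case
  the products on the plane of \<open>e\<^sub>1, e\<^sub>2\<close> vanish and \<open>v \<mapsto> v e\<^sub>3\<close> is a real scalar, which
  gives \<open>H01\<close> or \<open>H02\<close>; in the second case the plane multiplies into the line of \<open>e\<^sub>3\<close> by a
  rotation invariant form, which gives \<open>H01\<close> or \<open>H03\<close>. Conversely every automorphism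
  maps \<open>e\<^sub>3\<close> to \<open>\<plusminus>e\<^sub>3\<close> modulo the plane, with the sign \<open>-1\<close> possible only for \<open>\<beta> = 0\<close>,
  and comparing \<open>e\<^sub>1e\<^sub>1\<close>, \<open>e\<^sub>1e\<^sub>3\<close> and \<open>e\<^sub>3e\<^sub>3\<close> separates the list.\<close>

section \<open>A common kernel vector of eigenvalue-shifting matrices\<close>

text \<open>\<open>p\<close> is the characteristic polynomial det(z - M), expanded by the rule of
  Sarrus so that its degree can be read off.\<close>

lemma eigenvalues_eq_poly_roots:
  fixes M :: "complex^3^3"
  shows "\<exists>p. degree p = 3 \<and> (\<forall>z. poly p z = 0 \<longleftrightarrow> (\<exists>x. x \<noteq> 0 \<and> M *v x = z *s x))"
proof -
  define p where "p = [:- M$1$1, 1:] * [:- M$2$2, 1:] * [:- M$3$3, 1:]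
     + [:- (M$1$2 * M$2$3 * M$3$1) - M$1$3 * M$2$1 * M$3$2:]
     - smult (M$2$3 * M$3$2) [:- M$1$1, 1:] - smult (M$1$2 * M$2$1) [:- M$3$3, 1:]
     - smult (M$1$3 * M$3$1) [:- M$2$2, 1:]"
  have "degree p = 3"
    by (simp add: p_def)
  moreover have "poly p z = det (mat z - M)" for z
    by (simp add: p_def det_3 mat_def algebra_simps)
  moreover have "det (mat z - M) = 0 \<longleftrightarrow> (\<exists>x. x \<noteq> 0 \<and> M *v x = z *s x)" for z
  proof -
    have "mat z *v x = z *s x" for x :: "complex^3"
      by (simp add: vec_eq_iff forall_3 matrix_vector_mult_def sum_3 mat_def)
    then have "(mat z - M) *v x = 0 \<longleftrightarrow> M *v x = z *s x" for x
      by (auto simp: matrix_vector_mult_diff_rdistrib)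
    then show ?thesis
      using invertible_det_nz[of "mat z - M"] matrix_left_invertible_ker[of "mat z - M"]
        invertible_left_inverse[of "mat z - M"] by blast
  qed
  ultimately show ?thesis by (intro exI[of _ p]) simp
qed

lemma exists_eigenvector:
  fixes M :: "complex^3^3"
  obtains r x where "x \<noteq> 0" "M *v x = r *s x"
proof -
  obtain p where p: "degree p = 3" "\<And>z. poly p z = 0 \<longleftrightarrow> (\<exists>x. x \<noteq> 0 \<and> M *v x = z *s x)"
    using eigenvalues_eq_poly_roots by blast
  have "\<not> constant (poly p)" using p(1) by (simp add: constant_degree)
  then show ?thesis using fundamental_theorem_of_algebra p(2) that by blast
qed

lemma finite_eigenvalues:
  fixes M :: "complex^3^3"
  shows "finite {z. \<exists>x. x \<noteq> 0 \<and> M *v x = z *s x}"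
proof -
  obtain p where p: "degree p = 3" "\<And>z. poly p z = 0 \<longleftrightarrow> (\<exists>x. x \<noteq> 0 \<and> M *v x = z *s x)"
    using eigenvalues_eq_poly_roots by blast
  have "p \<noteq> 0" using p(1) by auto
  from poly_roots_finite[OF this] show ?thesis by (simp add: p(2))
qed

text \<open>By \<open>comm\<close>, \<open>N\<close> shifts eigenvalues of \<open>M\<close> by -a,
  so the nonzero iterates of \<open>N\<close> on \<open>x\<close> are eigenvectors for the pairwise
  distinct values r - j a. There are only finitely many eigenvalues, hence the iterates reach 0, and
  the last nonzero one is the required vector.\<close>

lemma eigenvector_in_kernel:
  fixes M N :: "complex^3^3"
  assumes comm: "\<And>v. N *v (M *v v) - M *v (N *v v) = a *s (N *v v)" and "a \<noteq> 0"
    and "x \<noteq> 0" and x: "M *v x = r *s x"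
  obtains j r' where "((*v) N ^^ j) x \<noteq> 0" "N *v ((*v) N ^^ j) x = 0"
    "M *v ((*v) N ^^ j) x = r' *s ((*v) N ^^ j) x"
proof -
  define y where "y j = ((*v) N ^^ j) x" for j
  have y_Suc: "y (Suc j) = N *v y j" for j by (simp add: y_def)
  have MN: "M *v (N *v v) = N *v (M *v v) - a *s (N *v v)" for v
    by (simp flip: comm)
  have eig: "M *v y j = (r - of_nat j * a) *s y j" for j
  proof (induction j)
    case 0
    then show ?case using x by (simp add: y_def)
  next
    case (Suc j)
    have "M *v y (Suc j) = (r - of_nat j * a) *s y (Suc j) - a *s y (Suc j)"
      by (simp only: y_Suc MN Suc.IH vector_scalar_commute)
    also have "\<dots> = (r - of_nat (Suc j) * a) *s y (Suc j)"
      unfolding vector_sub_rdistrib[symmetric] by (simp add: algebra_simps)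
    finally show ?case .
  qed
  have "\<exists>j. y j = 0"
  proof (rule ccontr)
    assume "\<nexists>j. y j = 0"
    then have "range (\<lambda>j. r - of_nat j * a) \<subseteq> {z. \<exists>x. x \<noteq> 0 \<and> M *v x = z *s x}"
      using eig by blast
    then have "finite (range (\<lambda>j. r - of_nat j * a))"
      using finite_eigenvalues finite_subset by blast
    moreover have "inj (\<lambda>j. r - of_nat j * a)" using \<open>a \<noteq> 0\<close> by (auto intro!: injI)
    ultimately show False using finite_imageD infinite_UNIV_nat by blast
  qed
  then obtain j where "y j = 0" by blast
  moreover have "y 0 \<noteq> 0" using \<open>x \<noteq> 0\<close> by (simp add: y_def)
  ultimately obtain i where "y i \<noteq> 0" "y (Suc i) = 0"
    using ex_least_nat_less[of "\<lambda>j. y j = 0" j] by (metis less_imp_le order_refl lessI)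
  then show ?thesis using that[OF _ _ eig[of i, unfolded y_def]] by (simp add: y_def)
qed

lemma common_kernel:
  fixes M N N' :: "complex^3^3"
  assumes "\<And>v. N *v (M *v v) - M *v (N *v v) = a *s (N *v v)" "a \<noteq> 0"
    and "\<And>v. N' *v (M *v v) - M *v (N' *v v) = b *s (N' *v v)" "b \<noteq> 0"
    and comm: "\<And>v. N *v (N' *v v) = N' *v (N *v v)"
  obtains y where "y \<noteq> 0" "N *v y = 0" "N' *v y = 0"
proof -
  obtain x r where "x \<noteq> 0" "M *v x = r *s x" by (rule exists_eigenvector)
  from eigenvector_in_kernel[OF assms(1,2) this] obtain z s
    where z: "z \<noteq> 0" "N *v z = 0" "M *v z = s *s z" by metis
  from eigenvector_in_kernel[OF assms(3,4) z(1,3)] obtain j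
    where j: "((*v) N' ^^ j) z \<noteq> 0" "N' *v ((*v) N' ^^ j) z = 0" by metis
  \<comment> \<open>\<open>N'\<close> commutes with \<open>N\<close>, so iterating \<open>N'\<close>
    never leaves the kernel of \<open>N\<close>.\<close>
  have "N *v ((*v) N' ^^ i) z = 0" for i
  proof (induction i)
    case (Suc i)
    then show ?case by (simp add: comm)
  qed (simp add: z)
  then show ?thesis using that j by blast
qed

section \<open>Complexification of real vectors and linear maps\<close>

definition complex_vector :: "real^'n \<Rightarrow> real^'n \<Rightarrow> complex^'n" where
  "complex_vector a b = (\<chi> i. Complex (a $ i) (b $ i))"

definition complex_matrix :: "(real^'n \<Rightarrow> real^'n) \<Rightarrow> (real^'n \<Rightarrow> real^'n) \<Rightarrow> complex^'n^'n" where
  "complex_matrix f g = (\<chi> i j. Complex (f (axis j 1) $ i) (g (axis j 1) $ i))"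

lemma complex_vector_surj: "\<exists>a b. y = complex_vector a b"
  by (rule exI[of _ "\<chi> i. Re (y $ i)"], rule exI[of _ "\<chi> i. Im (y $ i)"])
    (simp add: complex_vector_def vec_eq_iff)

lemma complex_vector_eq_0_iff: "complex_vector a b = 0 \<longleftrightarrow> a = 0 \<and> b = 0"
  by (auto simp: complex_vector_def vec_eq_iff complex_eq_iff)

text \<open>\<open>complex_matrix f g\<close> stands for f + i g, and the right-hand side is (f + i
  g)(a + i b) split into real and imaginary parts.\<close>

lemma complex_matrix_mult:
  assumes "linear f" "linear g"
  shows "complex_matrix f g *v complex_vector a b = complex_vector (f a - g b) (f b + g a)"
proof -
  have "(\<Sum>j\<in>UNIV. h (axis j 1) $ i * x $ j) = h x $ i" if "linear h" for h :: "real^'n \<Rightarrow> real^'n" and x i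
  proof -
    have "h x = h (\<Sum>j\<in>UNIV. x $ j *\<^sub>R axis j 1)"
      by (simp add: basis_expansion flip: scalar_mult_eq_scaleR)
    then show ?thesis
      by (simp add: linear_sum[OF that] linear_scale[OF that] mult.commute)
  qed
  from this[OF assms(1)] this[OF assms(2)] show ?thesis
    by (simp add: complex_vector_def complex_matrix_def matrix_vector_mult_def vec_eq_iff
        complex_eq_iff sum.distrib sum_subtractf)
qed

section \<open>Isomorphisms and automorphisms\<close>

text \<open>Evaluating at images under \<open>\<Psi>\<close> removes \<open>inv \<Psi>\<close>; this
  form can be checked coordinatewise.\<close>

lemma isomorphic_connections_iff:
  "isomorphic_connections br n1 n2 \<longleftrightarrow>
     (\<exists>\<Psi>. lie_automorphism br \<Psi> \<and> (\<forall>X Y. n2 (\<Psi> X) (\<Psi> Y) = \<Psi> (n1 X Y)))"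
proof -
  have "(\<forall>X. n2 X = \<Psi> \<circ> n1 (inv \<Psi> X) \<circ> inv \<Psi>) \<longleftrightarrow> (\<forall>X Y. n2 (\<Psi> X) (\<Psi> Y) = \<Psi> (n1 X Y))"
    if "bij \<Psi>" for \<Psi>
    unfolding fun_eq_iff o_def
    using that by (metis bij_inv_eq_iff)
  then show ?thesis
    unfolding isomorphic_connections_def lie_automorphism_def by blast
qed

lemma lie_automorphism_inv:
  assumes "lie_automorphism br \<Psi>"
  shows "lie_automorphism br (inv \<Psi>)"
proof -
  have b: "bij \<Psi>" and l: "linear \<Psi>" and h: "\<And>X Y. \<Psi> (br X Y) = br (\<Psi> X) (\<Psi> Y)"
    using assms by (auto simp: lie_automorphism_def)
  have i: "inv \<Psi> X = Y \<longleftrightarrow> X = \<Psi> Y" for X Y using bij_inv_eq_iff[OF b] by metis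
  have r: "\<Psi> (inv \<Psi> X) = X" for X using i by metis
  show ?thesis
    unfolding lie_automorphism_def
    by (intro conjI allI linearI bij_imp_bij_inv b)
      (simp_all add: i h r linear_add[OF l] linear_scale[OF l])
qed

lemma lie_automorphism_comp:
  assumes "lie_automorphism br \<Psi>" "lie_automorphism br \<Phi>"
  shows "lie_automorphism br (\<Phi> \<circ> \<Psi>)"
  using assms unfolding lie_automorphism_def by (simp add: linear_compose bij_comp)

lemma isomorphic_connections_sym:
  assumes "isomorphic_connections br n1 n2"
  shows "isomorphic_connections br n2 n1"
proof -
  from assms obtain \<Psi> where \<Psi>: "lie_automorphism br \<Psi>" "\<And>X Y. n2 (\<Psi> X) (\<Psi> Y) = \<Psi> (n1 X Y)"
    unfolding isomorphic_connections_iff by blast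
  then have "bij \<Psi>" by (simp add: lie_automorphism_def)
  then have "n1 (inv \<Psi> X) (inv \<Psi> Y) = inv \<Psi> (n2 X Y)" for X Y
    using \<Psi>(2) by (metis bij_inv_eq_iff)
  then show ?thesis
    using lie_automorphism_inv[OF \<Psi>(1)] unfolding isomorphic_connections_iff by blast
qed

lemma isomorphic_connections_trans:
  assumes "isomorphic_connections br n1 n2" "isomorphic_connections br n2 n3"
  shows "isomorphic_connections br n1 n3"
proof -
  from assms obtain \<Psi> \<Phi> where "lie_automorphism br \<Psi>" "\<And>X Y. n2 (\<Psi> X) (\<Psi> Y) = \<Psi> (n1 X Y)"
    and "lie_automorphism br \<Phi>" "\<And>X Y. n3 (\<Phi> X) (\<Phi> Y) = \<Phi> (n2 X Y)"
    unfolding isomorphic_connections_iff by blast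
  then show ?thesis
    unfolding isomorphic_connections_iff
    by (intro exI[of _ "\<Phi> \<circ> \<Psi>"]) (simp add: lie_automorphism_comp)
qed

text \<open>The pushforward along \<open>\<Psi>\<close>. It permits passing to an isomorphic
  connection in which a chosen vector has a convenient position.\<close>

lemma flat_lie_algebra_transport:
  assumes "lie_automorphism br \<Psi>" "flat_lie_algebra br n1"
  obtains n2 where "flat_lie_algebra br n2" "isomorphic_connections br n1 n2"
    "\<And>X Y. n2 (\<Psi> X) (\<Psi> Y) = \<Psi> (n1 X Y)"
proof -
  have b: "bij \<Psi>" and l: "linear \<Psi>" and h: "\<And>X Y. \<Psi> (br X Y) = br (\<Psi> X) (\<Psi> Y)"
    using assms by (auto simp: lie_automorphism_def)
  have l': "linear (inv \<Psi>)" using lie_automorphism_inv[OF assms(1)] by (simp add: lie_automorphism_def)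
  have i: "inv \<Psi> (\<Psi> X) = X" for X using bij_inv_eq_iff[OF b] by metis
  have surj: "\<exists>X. Y = \<Psi> X" for Y using b by (meson bij_pointE)
  define n2 where "n2 X Y = \<Psi> (n1 (inv \<Psi> X) (inv \<Psi> Y))" for X Y
  have n2: "n2 (\<Psi> X) (\<Psi> Y) = \<Psi> (n1 X Y)" for X Y by (simp add: n2_def i)
  have n1: "lie_bracket br" "bilinear n1" "torsion_free br n1" "flat_connection br n1"
    using assms(2) by (auto simp: flat_lie_algebra_def)
  have "bilinear n2"
    using n1(2) unfolding bilinear_def n2_def
    by (auto intro!: linear_compose[OF _ l, unfolded o_def] linear_compose[OF l', unfolded o_def])
  moreover have "torsion_free br n2"
    unfolding torsion_free_def
  proof (intro allI)
    fix X Y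
    obtain X' Y' where [simp]: "X = \<Psi> X'" "Y = \<Psi> Y'" using surj by metis
    show "n2 X Y - n2 Y X = br X Y"
      using n1(3) by (simp add: n2 torsion_free_def flip: linear_diff[OF l] h)
  qed
  moreover have "flat_connection br n2"
    unfolding flat_connection_def
  proof (intro allI)
    fix X Y Z
    obtain X' Y' Z' where [simp]: "X = \<Psi> X'" "Y = \<Psi> Y'" "Z = \<Psi> Z'" using surj by metis
    show "n2 X (n2 Y Z) - n2 Y (n2 X Z) - n2 (br X Y) Z = 0"
      using n1(4) linear_0[OF l] by (simp add: n2 flat_connection_def flip: linear_diff[OF l] h)
  qed
  ultimately have "flat_lie_algebra br n2" using n1 by (simp add: flat_lie_algebra_def)
  moreover have "isomorphic_connections br n1 n2"
    unfolding isomorphic_connections_iff using assms(1) n2 by blast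
  ultimately show ?thesis using that n2 by blast
qed

section \<open>The Lie algebra \<open>g35 \<beta>\<close> and its automorphisms\<close>

lemma vector_3_expand: "(X::real^3) = X$1 *\<^sub>R e1 + X$2 *\<^sub>R e2 + X$3 *\<^sub>R e3"
  by (simp add: vec_eq_iff forall_3 axis_def)

lemma bilinear_eqI_3:
  fixes f g :: "real^3 \<Rightarrow> real^3 \<Rightarrow> real^3"
  assumes "bilinear f" "bilinear g" "\<And>i j. f (axis i 1) (axis j 1) = g (axis i 1) (axis j 1)"
  shows "f = g"
  by (rule bilinear_eq_stdbasis[OF assms(1,2)]) (use assms(3) in \<open>auto simp: Basis_vec_def\<close>)

lemma g35_simps:
  "g35 \<beta> X Y $ 1 = \<beta> * (X$1 * Y$3 - X$3 * Y$1) + (X$2 * Y$3 - X$3 * Y$2)"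
  "g35 \<beta> X Y $ 2 = \<beta> * (X$2 * Y$3 - X$3 * Y$2) - (X$1 * Y$3 - X$3 * Y$1)"
  "g35 \<beta> X Y $ 3 = 0"
  by (simp_all add: g35_def bilinear_of_table_def sum_3 axis_def algebra_simps)

text \<open>With e1, e2 read as 1, i, the plane is a complex line on which ad e3 is multiplication
  by -\<beta> + i. The map multiplies the plane by p + i q, which commutes with ad e3, and sends e3
  to e3 + a e1 + b e2.\<close>

definition similarity :: "real \<Rightarrow> real \<Rightarrow> real \<Rightarrow> real \<Rightarrow> real^3 \<Rightarrow> real^3" where
  "similarity p q a b X =
     vector [p * X$1 - q * X$2 + a * X$3, q * X$1 + p * X$2 + b * X$3, X$3]"

lemma similarity_simps [simp]:
  "similarity p q a b X $ 1 = p * X$1 - q * X$2 + a * X$3"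
  "similarity p q a b X $ 2 = q * X$1 + p * X$2 + b * X$3"
  "similarity p q a b X $ 3 = X$3"
  by (simp_all add: similarity_def)

lemma linear_similarity: "linear (similarity p q a b)"
  by (rule linearI) (simp_all add: vec_eq_iff forall_3 algebra_simps)

lemma lie_automorphism_similarity:
  assumes "p\<^sup>2 + q\<^sup>2 \<noteq> 0"
  shows "lie_automorphism (g35 \<beta>) (similarity p q a b)"
proof -
  note l = linear_similarity[of p q a b]
  have "X = 0" if "similarity p q a b X = 0" for X
  proof -
    have 3: "X$3 = 0" using that similarity_simps(3)[of p q a b X] by simp
    have 1: "p * X$1 - q * X$2 = 0" "q * X$1 + p * X$2 = 0"
      using that 3 similarity_simps(1,2)[of p q a b X] by simp_all
    \<comment> \<open>Multiplication by the conjugate p - i q.\<close>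
    have "(p\<^sup>2 + q\<^sup>2) * X$1 = 0" "(p\<^sup>2 + q\<^sup>2) * X$2 = 0"
      using 1 by algebra+
    then have "X$1 = 0" "X$2 = 0" using assms by (simp_all del: sum_power2_eq_zero_iff)
    then show ?thesis using 3 by (simp add: vec_eq_iff forall_3)
  qed
  then have "inj (similarity p q a b)" using linear_injective_0[OF l] by blast
  then have "bij (similarity p q a b)"
    using linear_injective_imp_surjective[OF l] by (simp add: bij_def)
  with l show ?thesis
    by (auto simp: lie_automorphism_def vec_eq_iff forall_3 g35_simps algebra_simps)
qed

text \<open>The plane is the derived algebra, hence invariant, and on it \<open>\<Psi>\<close>
  intertwines ad e3 with t ad e3. Comparing the eigenvalues -\<beta> +- i leaves t = 1, or t = -1
  with \<beta> = 0.\<close>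

lemma g35_automorphism_cases:
  assumes "lie_automorphism (g35 \<beta>) \<Psi>"
  obtains p q t where "\<Psi> e1 $ 1 = p" "\<Psi> e1 $ 2 = q" "\<Psi> e1 $ 3 = 0" "\<Psi> e3 $ 3 = t"
    "p\<^sup>2 + q\<^sup>2 > 0" "t = 1 \<or> \<beta> = 0 \<and> t = -1"
proof -
  have b: "bij \<Psi>" and l: "linear \<Psi>" and h: "\<And>X Y. \<Psi> (g35 \<beta> X Y) = g35 \<beta> (\<Psi> X) (\<Psi> Y)"
    using assms by (auto simp: lie_automorphism_def)
  define p q r w t where "p = \<Psi> e1 $ 1" "q = \<Psi> e1 $ 2" "r = \<Psi> e2 $ 1" "w = \<Psi> e2 $ 2" "t = \<Psi> e3 $ 3"
  have "g35 \<beta> e1 e3 = \<beta> *\<^sub>R e1 - e2" "g35 \<beta> e2 e3 = e1 + \<beta> *\<^sub>R e2"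
    by (simp_all add: vec_eq_iff forall_3 g35_simps axis_def)
  with h[of e1 e3] h[of e2 e3]
  have E: "\<beta> *\<^sub>R \<Psi> e1 - \<Psi> e2 = g35 \<beta> (\<Psi> e1) (\<Psi> e3)" "\<Psi> e1 + \<beta> *\<^sub>R \<Psi> e2 = g35 \<beta> (\<Psi> e2) (\<Psi> e3)"
    by (simp_all add: linear_diff[OF l] linear_add[OF l] linear_scale[OF l])
  from E have "\<beta> * \<Psi> e1 $ 3 - \<Psi> e2 $ 3 = 0" "\<Psi> e1 $ 3 + \<beta> * \<Psi> e2 $ 3 = 0"
    by (simp_all add: vec_eq_iff forall_3 g35_simps)
  then have "(1 + \<beta>\<^sup>2) * \<Psi> e1 $ 3 = 0" "\<Psi> e2 $ 3 = \<beta> * \<Psi> e1 $ 3" by algebra+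
  moreover have "1 + \<beta>\<^sup>2 \<noteq> 0" by (simp add: add_nonneg_eq_0_iff)
  ultimately have 3: "\<Psi> e1 $ 3 = 0" "\<Psi> e2 $ 3 = 0" by auto
  have E': "\<beta> * p - r = t * (\<beta> * p + q)" "\<beta> * q - w = t * (\<beta> * q - p)"
      "p + \<beta> * r = t * (\<beta> * r + w)" "q + \<beta> * w = t * (\<beta> * w - r)"
    using E[THEN arg_cong, of "\<lambda>X. X$1"] E[THEN arg_cong, of "\<lambda>X. X$2"]
    unfolding p_q_r_w_t_def by (simp_all add: g35_simps 3) (simp_all (no_asm) add: algebra_simps)
  have "\<Psi> e1 \<noteq> 0"
    using b linear_0[OF l] by (metis axis_eq_0_iff bij_pointE zero_neq_one)
  then have pq: "p\<^sup>2 + q\<^sup>2 > 0"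
    using 3 by (auto simp: vec_eq_iff forall_3 p_q_r_w_t_def sum_power2_gt_zero_iff)
  have "t \<noteq> 0"
  proof
    assume "t = 0"
    then have "\<Psi> X $ 3 = 0" for X
      using arg_cong[OF vector_3_expand[of X], of \<Psi>] 3
      by (simp add: linear_add[OF l] linear_scale[OF l] p_q_r_w_t_def)
    moreover obtain X where "\<Psi> X = e3" using b by (metis bij_pointE)
    ultimately show False by (metis axis_nth zero_neq_one)
  qed
  \<comment> \<open>Eliminating r and w from \<open>E'\<close> gives (p + i q)(1 + (d + i t)^2) = 0.
    The next two equations are the real and imaginary parts after multiplication by p - i q.\<close>
  define d where "d = \<beta> * (1 - t)"
  have "(p\<^sup>2 + q\<^sup>2) * (1 + d\<^sup>2 - t\<^sup>2) = 0" "(p\<^sup>2 + q\<^sup>2) * (2 * t * d) = 0"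
    using E' unfolding d_def by algebra+
  then have "1 + d\<^sup>2 - t\<^sup>2 = 0" "d = 0" using pq \<open>t \<noteq> 0\<close> by auto
  then have "t\<^sup>2 = 1" "\<beta> = 0 \<or> t = 1" by (auto simp: d_def)
  then have "t = 1 \<or> \<beta> = 0 \<and> t = -1" by (auto simp: power2_eq_1_iff)
  with that pq 3 show ?thesis unfolding p_q_r_w_t_def by blast
qed

lemma bilinear_of_table_axis: "bilinear_of_table c (axis i 1) (axis j 1) = c (i, j)"
  using exhaust_3[of i] exhaust_3[of j]
  by (elim disjE) (simp_all add: bilinear_of_table_def sum_3 axis_def)

lemma eq_bilinear_of_tableI:
  fixes f :: "real^3 \<Rightarrow> real^3 \<Rightarrow> real^3"
  assumes "bilinear f" "\<And>i j. f (axis i 1) (axis j 1) = c (i, j)"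
  shows "f = bilinear_of_table c"
  by (rule bilinear_eqI_3) (simp_all add: assms bilinear_of_table_bilinear bilinear_of_table_axis)

definition h_classified :: "real \<Rightarrow> (real^3 \<Rightarrow> real^3 \<Rightarrow> real^3) \<Rightarrow> bool" where
  "h_classified \<beta> n \<longleftrightarrow> (\<exists>k. \<exists>s\<in>h_params k. isomorphic_connections (g35 \<beta>) n (h_conn \<beta> k s))"

lemma h_classified_iso:
  assumes "isomorphic_connections (g35 \<beta>) n n'" "h_classified \<beta> n'"
  shows "h_classified \<beta> n"
  using assms isomorphic_connections_trans unfolding h_classified_def by blast

lemma similarity_isomorphism:
  assumes "p\<^sup>2 + q\<^sup>2 \<noteq> 0"
    and "\<And>X Y. n2 (similarity p q a b X) (similarity p q a b Y) = similarity p q a b (n1 X Y)"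
  shows "isomorphic_connections (g35 \<beta>) n1 n2"
  unfolding isomorphic_connections_iff using lie_automorphism_similarity[OF assms(1)] assms(2) by blast

text \<open>This is (i - m)(a + i b) = u + i v, solvable since i - m is nonzero for real m. It
  supplies the shear that removes the plane part of e3 e3.\<close>

lemma complex_linear_system:
  fixes m u v :: real
  obtains a b where "u = - m * a - b" "v = a - m * b"
proof
  have "m\<^sup>2 + 1 \<noteq> 0" by (simp add: add_nonneg_eq_0_iff)
  then show "u = - m * ((v - m * u) / (m\<^sup>2 + 1)) - (- u - m * v) / (m\<^sup>2 + 1)"
    "v = (v - m * u) / (m\<^sup>2 + 1) - m * ((- u - m * v) / (m\<^sup>2 + 1))"
    by (simp_all add: divide_simps) (simp_all add: algebra_simps power2_eq_square)
qed

lemma trace_compose_commute: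
  fixes f g :: "real^'n \<Rightarrow> real^'n"
  assumes "linear f" "linear g"
  shows "(\<Sum>i\<in>UNIV. f (g (axis i 1)) $ i) = (\<Sum>i\<in>UNIV. g (f (axis i 1)) $ i)"
proof -
  have "trace (matrix (f \<circ> g)) = trace (matrix (g \<circ> f))"
    unfolding matrix_compose[OF assms] matrix_compose[OF assms(2,1)] by (rule trace_mul_sym)
  then show ?thesis by (simp add: trace_def matrix_def)
qed

section \<open>Flat connections\<close>

locale flat_g35 =
  fixes \<beta> :: real and n :: "real^3 \<Rightarrow> real^3 \<Rightarrow> real^3"
  assumes flat: "flat_lie_algebra (g35 \<beta>) n"
begin

lemma bil: "bilinear n"
  using flat by (simp add: flat_lie_algebra_def)

lemma linear_n: "linear (n v)"
  using bil by (simp add: bilinear_def)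

lemma n_zero [simp]: "n v 0 = 0" "n 0 v = 0"
  using bil by (simp_all add: bilinear_rzero bilinear_lzero)

lemma n_expand: "n v x = x$1 *\<^sub>R n v e1 + x$2 *\<^sub>R n v e2 + x$3 *\<^sub>R n v e3"
  using arg_cong[OF vector_3_expand[of x], of "n v"]
  by (simp add: linear_add[OF linear_n] linear_scale[OF linear_n])

lemma n_expand_left: "n x v = x$1 *\<^sub>R n e1 v + x$2 *\<^sub>R n e2 v + x$3 *\<^sub>R n e3 v"
  using arg_cong[OF vector_3_expand[of x], of "\<lambda>x. n x v"]
  by (simp add: bilinear_ladd[OF bil] bilinear_lmul[OF bil])

lemma brackets:
  "g35 \<beta> e1 e2 = 0" "g35 \<beta> e1 e3 = \<beta> *\<^sub>R e1 - e2" "g35 \<beta> e2 e3 = e1 + \<beta> *\<^sub>R e2"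
  by (simp_all add: vec_eq_iff forall_3 g35_simps axis_def)

lemma torsion:
  "n e2 e1 = n e1 e2" "n e3 e1 = n e1 e3 - \<beta> *\<^sub>R e1 + e2" "n e3 e2 = n e2 e3 - e1 - \<beta> *\<^sub>R e2"
proof -
  have t: "n X Y - n Y X = g35 \<beta> X Y" for X Y
    using flat by (simp add: flat_lie_algebra_def torsion_free_def)
  show "n e2 e1 = n e1 e2" using t[of e1 e2] by (simp add: brackets)
  show "n e3 e1 = n e1 e3 - \<beta> *\<^sub>R e1 + e2"
    using t[of e1 e3] by (simp add: brackets algebra_simps)
  show "n e3 e2 = n e2 e3 - e1 - \<beta> *\<^sub>R e2"
    using t[of e2 e3] by (simp add: brackets algebra_simps)
qed

lemma curvature:
  "n e1 (n e2 z) = n e2 (n e1 z)"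
  "n e1 (n e3 z) - n e3 (n e1 z) = \<beta> *\<^sub>R n e1 z - n e2 z"
  "n e2 (n e3 z) - n e3 (n e2 z) = n e1 z + \<beta> *\<^sub>R n e2 z"
proof -
  have "n X (n Y Z) - n Y (n X Z) = n (g35 \<beta> X Y) Z" for X Y Z
    using flat by (simp add: flat_lie_algebra_def flat_connection_def)
  note c = this[of _ _ z]
  show "n e1 (n e2 z) = n e2 (n e1 z)"
    using c[of e1 e2] by (simp add: brackets)
  show "n e1 (n e3 z) - n e3 (n e1 z) = \<beta> *\<^sub>R n e1 z - n e2 z"
    "n e2 (n e3 z) - n e3 (n e2 z) = n e1 z + \<beta> *\<^sub>R n e2 z"
    unfolding c by (simp_all add: brackets bilinear_ladd[OF bil] bilinear_lsub[OF bil] bilinear_lmul[OF bil])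
qed

lemma common_kernel_vector:
  obtains k where "k \<noteq> 0" "n e1 k = 0" "n e2 k = 0"
proof -
  define M N N' where "M = complex_matrix (n e3) (\<lambda>_. 0)"
    and "N = complex_matrix (n e1) (n e2)" and "N' = complex_matrix (n e1) (\<lambda>x. - n e2 x)"
  have neg: "linear (\<lambda>x. - n e2 x)" using linear_n by (simp add: linear_compose_neg)
  have M: "M *v complex_vector a b = complex_vector (n e3 a) (n e3 b)"
    and N: "N *v complex_vector a b = complex_vector (n e1 a - n e2 b) (n e1 b + n e2 a)"
    and N': "N' *v complex_vector a b = complex_vector (n e1 a + n e2 b) (n e1 b - n e2 a)" for a b
    by (simp_all add: M_def N_def N'_def complex_matrix_mult linear_n neg linear_zero)
  have c1: "n e1 (n e3 z) = n e3 (n e1 z) + \<beta> *\<^sub>R n e1 z - n e2 z"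
    and c2: "n e2 (n e3 z) = n e3 (n e2 z) + n e1 z + \<beta> *\<^sub>R n e2 z" for z
    using curvature(2,3)[of z] by (simp_all add: algebra_simps)
  have [simp]: "complex_vector a b - complex_vector c d = complex_vector (a - c) (b - d)"
    "z *s complex_vector a b = complex_vector (Re z *\<^sub>R a - Im z *\<^sub>R b) (Re z *\<^sub>R b + Im z *\<^sub>R a)"
    for a b c d :: "real^3" and z
    by (simp_all add: complex_vector_def vec_eq_iff complex_eq_iff)
  note L = linear_add[OF linear_n] linear_diff[OF linear_n] linear_scale[OF linear_n]
  \<comment> \<open>\<open>curvature(2,3)\<close> combined with the coefficients 1 and i,
    respectively 1 and -i: L1 +- i L2 is an eigenvector of the commutator with L3, for the
    eigenvalue \<beta> +- i.\<close>
  have "N *v (M *v v) - M *v (N *v v) = Complex \<beta> 1 *s (N *v v)"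
    "N' *v (M *v v) - M *v (N' *v v) = Complex \<beta> (-1) *s (N' *v v)"
    "N *v (N' *v v) = N' *v (N *v v)" for v
  proof -
    obtain a b where "v = complex_vector a b" using complex_vector_surj by blast
    then show "N *v (M *v v) - M *v (N *v v) = Complex \<beta> 1 *s (N *v v)"
    "N' *v (M *v v) - M *v (N' *v v) = Complex \<beta> (-1) *s (N' *v v)"
    "N *v (N' *v v) = N' *v (N *v v)"
      by (simp_all add: M N N' L c1 c2 curvature(1) algebra_simps)
  qed
  from common_kernel[OF this(1) _ this(2) _ this(3)] obtain y
    where "y \<noteq> 0" "N *v y = 0" "N' *v y = 0" by (auto simp: complex_eq_iff)
  moreover obtain a b where "y = complex_vector a b" using complex_vector_surj by blast
  ultimately have ab: "a \<noteq> 0 \<or> b \<noteq> 0" and "n e1 a - n e2 b = 0" "n e1 b + n e2 a = 0"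
    "n e1 a + n e2 b = 0" "n e1 b - n e2 a = 0"
    by (auto simp: N N' complex_vector_eq_0_iff)
  \<comment> \<open>Vanishing under L1 + i L2 and L1 - i L2 means vanishing under L1 and L2. These
    are real, so they annihilate both the real part \<open>a\<close> and the imaginary part
    \<open>b\<close> of \<open>y\<close>.\<close>
  then have "2 *\<^sub>R n e1 a = 0" "2 *\<^sub>R n e2 a = 0" "2 *\<^sub>R n e1 b = 0" "2 *\<^sub>R n e2 b = 0"
    by (simp_all add: scaleR_2 algebra_simps add_eq_0_iff)
  then show ?thesis using ab that by auto
qed

section \<open>Normal forms according to the position of the kernel vector\<close>

lemma n_zero_left_plane:
  assumes "n e1 k = 0" "n e2 k = 0" "v $ 3 = 0"
  shows "n v k = 0"
  using n_expand_left[of v k] assms by simp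

lemma similarity_transport:
  assumes pq: "p\<^sup>2 + q\<^sup>2 \<noteq> 0" and k: "n e1 k = 0" "n e2 k = 0"
  obtains n' where "flat_g35 \<beta> n'" "isomorphic_connections (g35 \<beta>) n n'"
    "n' e1 (similarity p q a b k) = 0" "n' e2 (similarity p q a b k) = 0"
proof -
  let ?S = "similarity p q a b"
  have aut: "lie_automorphism (g35 \<beta>) ?S" by (rule lie_automorphism_similarity[OF pq])
  obtain n' where n': "flat_lie_algebra (g35 \<beta>) n'" "isomorphic_connections (g35 \<beta>) n n'"
    "\<And>X Y. n' (?S X) (?S Y) = ?S (n X Y)"
    using flat_lie_algebra_transport[OF aut flat] by blast
  \<comment> \<open>The preimage of e1 or e2 is in general a mixture of both, so the vanishing is
    shown for the whole plane, which \<open>?S\<close> preserves.\<close>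
  have "n' v (?S k) = 0" if "v $ 3 = 0" for v
  proof -
    obtain w where w: "v = ?S w" using aut unfolding lie_automorphism_def by (meson bij_pointE)
    then have "n w k = 0" using that k by (simp add: n_zero_left_plane)
    then show ?thesis using n'(3)[of w k] linear_0[OF linear_similarity] by (simp add: w)
  qed
  from this[of e1] this[of e2] show ?thesis using that n' by (simp add: flat_g35_def axis_def)
qed

text \<open>\<beta> L1 - L2 and L1 + \<beta> L2 are commutators with L3 and have trace 0. The
  coefficient determinant 1 + \<beta>^2 is nonzero, so L2 has trace 0.\<close>

lemma trace_n_e2: "n e2 e1 $ 1 + n e2 e2 $ 2 + n e2 e3 $ 3 = 0"
proof -
  define A where "A v = n v e1 $ 1 + n v e2 $ 2 + n v e3 $ 3" for v
  have tr: "(\<Sum>i\<in>UNIV. n v (n e3 (axis i 1)) $ i) = (\<Sum>i\<in>UNIV. n e3 (n v (axis i 1)) $ i)" for v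
    by (rule trace_compose_commute) (rule linear_n)+
  have "\<beta> * A e1 - A e2 = (\<Sum>i\<in>UNIV. (\<beta> *\<^sub>R n e1 (axis i 1) - n e2 (axis i 1)) $ i)"
    by (simp add: A_def sum_3 algebra_simps)
  also have "\<dots> = 0"
    unfolding curvature(2)[symmetric] by (simp add: sum_subtractf tr)
  finally have 1: "\<beta> * A e1 - A e2 = 0" .
  have "A e1 + \<beta> * A e2 = (\<Sum>i\<in>UNIV. (n e1 (axis i 1) + \<beta> *\<^sub>R n e2 (axis i 1)) $ i)"
    by (simp add: A_def sum_3 algebra_simps)
  also have "\<dots> = 0"
    unfolding curvature(3)[symmetric] by (simp add: sum_subtractf tr)
  finally have "(1 + \<beta>\<^sup>2) * A e2 = 0" using 1 by algebra
  moreover have "1 + \<beta>\<^sup>2 \<noteq> 0" by (simp add: add_nonneg_eq_0_iff)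
  ultimately show ?thesis by (simp add: A_def)
qed

text \<open>Flatness at e1 and e2, with the trace condition, makes all products in the plane vanish.
  Flatness at e3 then makes v -> v e3 a real scalar g with g = 0 or g = l, and a shear of e3 clears
  the plane part of e3 e3.\<close>

lemma classified_if_e1_in_kernel:
  assumes k: "n e1 e1 = 0" "n e2 e1 = 0"
  shows "h_classified \<beta> n"
proof -
  note lin = linear_add[OF linear_n] linear_diff[OF linear_n] linear_scale[OF linear_n]
  have e12: "n e1 e2 = 0" using k torsion(1) by simp
  define G H where GH: "G = n e1 e3" "H = n e2 e3"
  have e31: "n e3 e1 = G - \<beta> *\<^sub>R e1 + e2" and e32: "n e3 e2 = H - e1 - \<beta> *\<^sub>R e2"
    using torsion by (simp_all add: GH)
  have "n e1 G = 0"
    using curvature(2)[of e1] k e12 by (simp add: e31 lin)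
  then have "G $ 3 *\<^sub>R G = 0" using n_expand[of e1 G] k e12 by (simp add: GH)
  then have G3: "G $ 3 = 0" by auto
  have "n e1 H = - n e2 e2"
    using curvature(2)[of e2] k e12 by (simp add: e32 lin)
  then have "- n e2 e2 = H $ 3 *\<^sub>R G" using n_expand[of e1 H] k e12 by (simp add: GH)
  then have e22: "n e2 e2 = - (H $ 3 *\<^sub>R G)" by (metis minus_minus)
  have "n e2 G + n e2 e2 = 0"
    using curvature(3)[of e1] k e12 by (simp add: e31 lin)
  then have "(G $ 2 + 1) *\<^sub>R n e2 e2 = 0" using n_expand[of e2 G] k G3 by (simp add: scaleR_add_left)
  then have "(G $ 2 + 1) * (H $ 3 * G $ 2) = 0"
    by (auto simp: e22 vec_eq_iff forall_3)
  moreover have "H $ 3 = H $ 3 * G $ 2"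
    using trace_n_e2 k e22 by (simp add: GH)
  \<comment> \<open>Inserting H3 G2 = H3 into the product relation turns it into 2 H3 = 0.\<close>
  ultimately have H3: "H $ 3 = 0" by algebra
  then have e22: "n e2 e2 = 0" using e22 by simp
  define c1 c2 l where c: "c1 = n e3 e3 $ 1" "c2 = n e3 e3 $ 2" "l = n e3 e3 $ 3"
  have "n e1 (n e3 e3) = l *\<^sub>R G" "n e2 (n e3 e3) = l *\<^sub>R H"
    "n e3 G = G$1 *\<^sub>R (G - \<beta> *\<^sub>R e1 + e2) + G$2 *\<^sub>R (H - e1 - \<beta> *\<^sub>R e2)"
    "n e3 H = H$1 *\<^sub>R (G - \<beta> *\<^sub>R e1 + e2) + H$2 *\<^sub>R (H - e1 - \<beta> *\<^sub>R e2)"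
    using n_expand[of e1 "n e3 e3"] n_expand[of e2 "n e3 e3"] n_expand[of e3 G] n_expand[of e3 H]
      k e12 e22 G3 H3 by (simp_all add: c GH e31[unfolded GH] e32[unfolded GH])
  then have "l *\<^sub>R G - (G$1 *\<^sub>R (G - \<beta> *\<^sub>R e1 + e2) + G$2 *\<^sub>R (H - e1 - \<beta> *\<^sub>R e2)) = \<beta> *\<^sub>R G - H"
    "l *\<^sub>R H - (H$1 *\<^sub>R (G - \<beta> *\<^sub>R e1 + e2) + H$2 *\<^sub>R (H - e1 - \<beta> *\<^sub>R e2)) = G + \<beta> *\<^sub>R H"
    using curvature(2,3)[of e3] by (simp_all add: GH)
  note psi = this[THEN arg_cong, of "\<lambda>v. v $ 1"] this[THEN arg_cong, of "\<lambda>v. v $ 2"]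
  define S T where ST: "S = G$2 + H$1" "T = G$1 - H$2"
  have E1: "l * G$1 - G$1 * G$1 - G$2 * H$1 + S = 0" and E2: "l * G$2 - G$1 * G$2 - G$2 * H$2 - T = 0"
    and E3: "l * H$1 - H$1 * G$1 - H$1 * H$2 - T = 0" and E4: "l * H$2 - H$1 * G$2 - H$2 * H$2 - S = 0"
    using psi by (simp_all add: ST axis_def algebra_simps)
  text \<open>\<open>S\<close> and \<open>T\<close> are the components of the antilinear part of \<open>v \<mapsto> n v e3\<close>.\<close>
  have "T * (l - (G$1 + H$2)) + 2 * S = 0"
    using E1 E4 by (simp add: ST algebra_simps)
  moreover have "S * (l - (G$1 + H$2)) - 2 * T = 0"
    using E2 E3 by (simp add: ST algebra_simps)
  \<comment> \<open>S times the first relation minus T times the second is 2 (S^2 + T^2) =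
    0.\<close>
  ultimately have "S\<^sup>2 + T\<^sup>2 = 0" by algebra
  then have ST0: "S = 0" "T = 0" by (simp_all add: sum_power2_eq_zero_iff)
  then have HG: "H$1 = - G$2" "H$2 = G$1" by (simp_all add: ST)
  \<comment> \<open>On the plane, v -> n v e3 is now multiplication by the complex number c = G1 + i
    G2, and \<open>E1\<close>, \<open>E2\<close> say c^2 = l c. Hence c is 0 or l, in particular
    real.\<close>
  have "G$2 = 0"
  proof (rule ccontr)
    assume "G$2 \<noteq> 0"
    moreover have "G$2 * (l - 2 * G$1) = 0" using E2 by (simp add: ST0 HG algebra_simps)
    ultimately have "l = 2 * G$1" by simp
    then have "(G$1)\<^sup>2 + (G$2)\<^sup>2 = 0" using E1 by (simp add: ST0 HG power2_eq_square)
    then show False using \<open>G$2 \<noteq> 0\<close> by simp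
  qed
  moreover define g where "g = G$1"
  ultimately have G: "G = g *\<^sub>R e1" and H: "H = g *\<^sub>R e2" and g: "g = 0 \<or> g = l"
    using HG G3 H3 E1 ST0 by (auto simp: vec_eq_iff forall_3 axis_def algebra_simps)
  have e33: "n e3 e3 = c1 *\<^sub>R e1 + c2 *\<^sub>R e2 + l *\<^sub>R e3"
    unfolding c by (rule vector_3_expand)
  have n: "n = bilinear_of_table ((\<lambda>_. 0)(
     (1,3) := g *\<^sub>R e1, (2,3) := g *\<^sub>R e2,
     (3,1) := (g - \<beta>) *\<^sub>R e1 + e2, (3,2) := - e1 + (g - \<beta>) *\<^sub>R e2,
     (3,3) := c1 *\<^sub>R e1 + c2 *\<^sub>R e2 + l *\<^sub>R e3))"
  proof (rule eq_bilinear_of_tableI[OF bil])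
    fix i j :: 3
    show "n (axis i 1) (axis j 1) = ((\<lambda>_. 0)(
     (1,3) := g *\<^sub>R e1, (2,3) := g *\<^sub>R e2,
     (3,1) := (g - \<beta>) *\<^sub>R e1 + e2, (3,2) := - e1 + (g - \<beta>) *\<^sub>R e2,
     (3,3) := c1 *\<^sub>R e1 + c2 *\<^sub>R e2 + l *\<^sub>R e3)) (i, j)"
      using exhaust_3[of i] exhaust_3[of j]
      by (elim disjE) (simp_all add: k e12 e22 e31 e32 e33 GH[symmetric] G H algebra_simps)
  qed
  \<comment> \<open>The overlap g = l = 0 is assigned to \<open>H01\<close>, as \<open>H02\<close>
    excludes the parameter 0.\<close>
  consider "g = 0" | "g = l" "l \<noteq> 0" using g by blast
  then show ?thesis
  proof cases
    case 1
    \<comment> \<open>The condition that the square of e3 + a e1 + b e2 in \<open>H01\<close> is the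
      image of e3 e3. In the case of \<open>H02\<close> the additional products of the plane with e3
      turn \<beta> + l into \<beta> - l.\<close>
    obtain a b where ab: "c1 = - (\<beta> + l) * a - b" "c2 = a - (\<beta> + l) * b"
      by (rule complex_linear_system)
    have "isomorphic_connections (g35 \<beta>) n (h_conn \<beta> H01 l)"
      by (rule similarity_isomorphism[of 1 0 _ a b])
        (simp_all add: n 1 ab bilinear_of_table_def vec_eq_iff forall_3 sum_3 axis_def algebra_simps)
    then show ?thesis unfolding h_classified_def by (intro exI[of _ H01] bexI[of _ l]) auto
  next
    case 2
    obtain a b where ab: "c1 = - (\<beta> - l) * a - b" "c2 = a - (\<beta> - l) * b"
      by (rule complex_linear_system)
    have "isomorphic_connections (g35 \<beta>) n (h_conn \<beta> H02 l)"
      by (rule similarity_isomorphism[of 1 0 _ a b])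
        (simp_all add: n 2 ab bilinear_of_table_def vec_eq_iff forall_3 sum_3 axis_def algebra_simps)
    then show ?thesis using 2 unfolding h_classified_def by (intro exI[of _ H02] bexI[of _ l]) auto
  qed
qed

lemma classified_if_plane_meets_kernel:
  assumes k: "n e1 k = 0" "n e2 k = 0" and "k \<noteq> 0" "k $ 3 = 0"
  shows "h_classified \<beta> n"
proof -
  define d where "d = (k$1)\<^sup>2 + (k$2)\<^sup>2"
  have d: "d \<noteq> 0" using assms(3,4) by (auto simp: d_def vec_eq_iff forall_3)
  then have "(k$1)\<^sup>2 + (- k$2)\<^sup>2 \<noteq> 0" by (simp add: d_def)
  \<comment> \<open>Multiplying by the conjugate of k1 + i k2 turns \<open>k\<close> into |k|^2
    e1.\<close>
  from similarity_transport[OF this k, of 0 0]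
  obtain n' where n': "flat_g35 \<beta> n'" "isomorphic_connections (g35 \<beta>) n n'"
    "n' e1 (similarity (k$1) (- k$2) 0 0 k) = 0" "n' e2 (similarity (k$1) (- k$2) 0 0 k) = 0" .
  interpret n': flat_g35 \<beta> n' by (rule n'(1))
  have "similarity (k$1) (- k$2) 0 0 k = d *\<^sub>R e1"
    using assms(4) by (simp add: vec_eq_iff forall_3 d_def axis_def power2_eq_square)
  then have "n' e1 e1 = 0" "n' e2 e1 = 0"
    using n'(3,4) d by (simp_all add: linear_scale[OF n'.linear_n])
  then show ?thesis using n'.classified_if_e1_in_kernel n'(2) h_classified_iso by blast
qed

text \<open>Flatness at e3 puts e3 e3 into the common kernel of L1 and L2. A nonzero plane part of
  it is then a kernel vector in the plane, which is the case already treated. Otherwise e3 e3 is a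
  multiple of e3 and the products in the plane are computed directly.\<close>

lemma classified_if_e3_in_kernel:
  assumes k: "n e1 e3 = 0" "n e2 e3 = 0"
  shows "h_classified \<beta> n"
proof (cases "n e3 e3 $ 1 = 0 \<and> n e3 e3 $ 2 = 0")
  case False
  define c where "c = n e3 e3 - n e3 e3 $ 3 *\<^sub>R e3"
  have "n e1 c = 0" "n e2 c = 0"
    using curvature(2,3)[of e3] k
    by (simp_all add: c_def linear_diff[OF linear_n] linear_scale[OF linear_n])
  moreover have "c $ 3 = 0" "c \<noteq> 0"
    using False by (auto simp: c_def axis_def vec_eq_iff forall_3)
  ultimately show ?thesis using classified_if_plane_meets_kernel by blast
next
  case True
  define l where "l = n e3 e3 $ 3"
  have e33: "n e3 e3 = l *\<^sub>R e3"
    using True by (simp add: l_def vec_eq_iff forall_3 axis_def)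
  have e31: "n e3 e1 = - \<beta> *\<^sub>R e1 + e2" and e32: "n e3 e2 = - e1 - \<beta> *\<^sub>R e2"
    using torsion k by simp_all
  define x y z where xyz: "x = n e1 e1" "y = n e1 e2" "z = n e2 e2"
  note lin = linear_add[OF linear_n] linear_diff[OF linear_n] linear_neg[OF linear_n] linear_scale[OF linear_n]
  have y: "n e2 e1 = y" using torsion by (simp add: xyz)
  have e3: "n e3 v = v$1 *\<^sub>R (- \<beta> *\<^sub>R e1 + e2) + v$2 *\<^sub>R (- e1 - \<beta> *\<^sub>R e2) + (l * v$3) *\<^sub>R e3" for v
    using n_expand[of e3 v] by (simp add: e31 e32 e33 mult.commute)
  \<comment> \<open>On the plane L3 equals ad e3, so flatness reads L3 (v w) = (L3 v) w + v (L3 w)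
    for v, w in the plane.\<close>
  have "- \<beta> *\<^sub>R x + y - n e3 x = \<beta> *\<^sub>R x - y" "- x - \<beta> *\<^sub>R y - n e3 y = \<beta> *\<^sub>R y - z"
    "- y - \<beta> *\<^sub>R z - n e3 z = y + \<beta> *\<^sub>R z"
    using curvature(2)[of e1] curvature(2)[of e2] curvature(3)[of e2]
    unfolding e31 e32 lin y xyz[symmetric] by simp_all
  note eqs = this[unfolded e3, THEN arg_cong, of "\<lambda>v. v $ 1"]
    this[unfolded e3, THEN arg_cong, of "\<lambda>v. v $ 2"]
    this[unfolded e3, THEN arg_cong, of "\<lambda>v. v $ 3"]
  have Y: "2 * y$1 = \<beta> * x$1 - x$2" "2 * y$2 = \<beta> * x$2 + x$1" "2 * y$3 = (2 * \<beta> + l) * x$3"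
    and Z: "z$1 = x$1 + \<beta> * y$1 - y$2" "z$2 = x$2 + \<beta> * y$2 + y$1" "z$3 = x$3 + (2 * \<beta> + l) * y$3"
    and YZ: "2 * y$1 = - (\<beta> * z$1 - z$2)" "2 * y$2 = - (\<beta> * z$2 + z$1)" "2 * y$3 = - ((2 * \<beta> + l) * z$3)"
    using eqs by (simp_all add: axis_def algebra_simps)
  text \<open>With \<open>b = \<beta> + \<i>\<close> acting on the plane these equations say \<open>2 y = b x\<close>,
    \<open>z = x + b y\<close> and \<open>2 y = - b z\<close>, so that \<open>(b\<^sup>2 + 4) b x = 0\<close>.\<close>
  have "(\<beta>\<^sup>2 + 1) * (x$1 + z$1) = 0" "(\<beta>\<^sup>2 + 1) * (x$2 + z$2) = 0"
    using Y(1,2) YZ(1,2) by algebra+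
  moreover have "\<beta>\<^sup>2 + 1 \<noteq> 0" by (simp add: add_nonneg_eq_0_iff)
  ultimately have zx: "z$1 = - x$1" "z$2 = - x$2" by (simp_all add: eq_neg_iff_add_eq_0 add.commute)
  \<comment> \<open>Real and imaginary parts, with b^2 + 4 = \<beta>^2 + 3 + 2 \<beta> i;
    multiplying by the conjugate then decouples the two coordinates.\<close>
  have "(\<beta>\<^sup>2 + 3) * x$1 - 2 * \<beta> * x$2 = 0" "(\<beta>\<^sup>2 + 3) * x$2 + 2 * \<beta> * x$1 = 0"
    using Y(1,2) Z(1,2) zx by algebra+
  then have "((\<beta>\<^sup>2 + 3)\<^sup>2 + (2 * \<beta>)\<^sup>2) * x$1 = 0" "((\<beta>\<^sup>2 + 3)\<^sup>2 + (2 * \<beta>)\<^sup>2) * x$2 = 0" by algebra+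
  moreover have "\<beta>\<^sup>2 + 3 > 0" by (simp add: add_nonneg_pos)
  then have "(\<beta>\<^sup>2 + 3)\<^sup>2 + (2 * \<beta>)\<^sup>2 > 0" by (intro add_pos_nonneg) auto
  then have "(\<beta>\<^sup>2 + 3)\<^sup>2 + (2 * \<beta>)\<^sup>2 \<noteq> 0" by linarith
  ultimately have x12: "x$1 = 0" "x$2 = 0" by (metis mult_eq_0_iff)+
  then have y12: "y$1 = 0" "y$2 = 0" using Y by simp_all
  define m where "m = x$3"
  \<comment> \<open>The third coordinates satisfy the same system with the real scalar 2 \<beta> + l
    in place of b. Unlike b, this scalar can be 0, which is what allows \<open>H03\<close>.\<close>
  have "(2 * \<beta> + l) * (((2 * \<beta> + l)\<^sup>2 + 4) * m) = 0"
    using Y(3) Z(3) YZ(3) unfolding m_def by algebra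
  moreover have "(2 * \<beta> + l)\<^sup>2 + 4 > 0" by (simp add: add_nonneg_pos)
  ultimately have lm: "2 * \<beta> + l = 0 \<or> m = 0" by auto
  then have "y$3 = 0" "z$3 = m" using Y(3) Z(3) by (auto simp: m_def)
  then have x: "x = m *\<^sub>R e3" "y = 0" "z = m *\<^sub>R e3"
    using x12 y12 zx by (simp_all add: vec_eq_iff forall_3 axis_def m_def)
  have n: "n = bilinear_of_table ((\<lambda>_. 0)(
     (1,1) := m *\<^sub>R e3, (2,2) := m *\<^sub>R e3,
     (3,1) := (- \<beta>) *\<^sub>R e1 + e2, (3,2) := - e1 - \<beta> *\<^sub>R e2, (3,3) := l *\<^sub>R e3))"
  proof (rule eq_bilinear_of_tableI[OF bil])
    fix i j :: 3
    show "n (axis i 1) (axis j 1) = ((\<lambda>_. 0)(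
     (1,1) := m *\<^sub>R e3, (2,2) := m *\<^sub>R e3,
     (3,1) := (- \<beta>) *\<^sub>R e1 + e2, (3,2) := - e1 - \<beta> *\<^sub>R e2, (3,3) := l *\<^sub>R e3)) (i, j)"
      using exhaust_3[of i] exhaust_3[of j]
      by (elim disjE) (simp_all add: k e31 e32 e33 y xyz[symmetric] x)
  qed
  show ?thesis
  proof (cases "m = 0")
    case True
    have "isomorphic_connections (g35 \<beta>) n (h_conn \<beta> H01 l)"
      by (rule similarity_isomorphism[of 1 0 _ 0 0])
        (simp_all add: n True bilinear_of_table_def vec_eq_iff forall_3 sum_3 axis_def algebra_simps)
    then show ?thesis unfolding h_classified_def by (intro exI[of _ H01] bexI[of _ l]) auto
  next
    case False
    \<comment> \<open>Scaling the plane by r divides the coefficient m of e3 in e1 e1 and e2 e2 by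
      r^2 = |m|, leaving the sign of m.\<close>
    define r where "r = sqrt \<bar>m\<bar>"
    have m: "m = sgn m * (r * r)" by (simp add: r_def sgn_mult_abs)
    have l: "l = - 2 * \<beta>" using lm False by simp
    have "isomorphic_connections (g35 \<beta>) n (h_conn \<beta> H03 (sgn m))"
    proof (rule similarity_isomorphism[of r 0 _ 0 0])
      show "r\<^sup>2 + 0\<^sup>2 \<noteq> 0" using False by (simp add: r_def)
      fix X Y
      have n': "n = bilinear_of_table ((\<lambda>_. 0)(
         (1,1) := (sgn m * (r * r)) *\<^sub>R e3, (2,2) := (sgn m * (r * r)) *\<^sub>R e3,
         (3,1) := (- \<beta>) *\<^sub>R e1 + e2, (3,2) := - e1 - \<beta> *\<^sub>R e2, (3,3) := (- 2 * \<beta>) *\<^sub>R e3))"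
        using n unfolding m[symmetric] l[symmetric] .
      show "h_conn \<beta> H03 (sgn m) (similarity r 0 0 0 X) (similarity r 0 0 0 Y) = similarity r 0 0 0 (n X Y)"
        unfolding n'
        by (simp add: bilinear_of_table_def vec_eq_iff forall_3 sum_3 axis_def algebra_simps)
    qed
    moreover have "sgn m = 1 \<or> sgn m = -1" using False by (simp add: sgn_if)
    ultimately show ?thesis unfolding h_classified_def by (intro exI[of _ H03] bexI[of _ "sgn m"]) auto
  qed
qed

lemma classified: "h_classified \<beta> n"
proof -
  obtain k where k: "k \<noteq> 0" "n e1 k = 0" "n e2 k = 0" by (rule common_kernel_vector)
  show ?thesis
  proof (cases "k $ 3 = 0")
    case True
    then show ?thesis using k classified_if_plane_meets_kernel by blast
  next
    case False
    \<comment> \<open>The shear e3 -> e3 + a e1 + b e2 with a, b chosen to cancel the plane part of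
      \<open>k\<close>.\<close>
    let ?k = "similarity 1 0 (- k$1 / k$3) (- k$2 / k$3) k"
    have "(1::real)\<^sup>2 + 0\<^sup>2 \<noteq> 0" by simp
    from similarity_transport[OF this k(2,3)]
    obtain n' where n': "flat_g35 \<beta> n'" "isomorphic_connections (g35 \<beta>) n n'"
      "n' e1 ?k = 0" "n' e2 ?k = 0" by metis
    interpret n': flat_g35 \<beta> n' by (rule n'(1))
    have "?k = k$3 *\<^sub>R e3"
      using False by (simp add: vec_eq_iff forall_3 axis_def)
    then have "n' e1 e3 = 0" "n' e2 e3 = 0"
      using n'(3,4) False by (simp_all add: linear_scale[OF n'.linear_n])
    then show ?thesis using n'.classified_if_e3_in_kernel n'(2) h_classified_iso by blast
  qed
qed

end

section \<open>Separation of the listed connections\<close>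

lemma h_conn_simps:
  "h_conn \<beta> H01 s X Y $ 1 = - X$3 * (\<beta> * Y$1 + Y$2)"
  "h_conn \<beta> H01 s X Y $ 2 = X$3 * (Y$1 - \<beta> * Y$2)"
  "h_conn \<beta> H01 s X Y $ 3 = s * X$3 * Y$3"
  "h_conn \<beta> H02 s X Y $ 1 = s * X$1 * Y$3 + X$3 * ((s - \<beta>) * Y$1 - Y$2)"
  "h_conn \<beta> H02 s X Y $ 2 = s * X$2 * Y$3 + X$3 * (Y$1 + (s - \<beta>) * Y$2)"
  "h_conn \<beta> H02 s X Y $ 3 = s * X$3 * Y$3"
  "h_conn \<beta> H03 s X Y $ 1 = - X$3 * (\<beta> * Y$1 + Y$2)"
  "h_conn \<beta> H03 s X Y $ 2 = X$3 * (Y$1 - \<beta> * Y$2)"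
  "h_conn \<beta> H03 s X Y $ 3 = s * (X$1 * Y$1 + X$2 * Y$2) - 2 * \<beta> * X$3 * Y$3"
  by (simp_all add: bilinear_of_table_def sum_3 axis_def algebra_simps)

lemma h_conn_basis:
  "h_conn \<beta> k s e1 e1 = (if k = H03 then s *\<^sub>R e3 else 0)"
  "h_conn \<beta> k s e1 e3 = (if k = H02 then s *\<^sub>R e1 else 0)"
  "h_conn \<beta> k s e3 e3 = (if k = H03 then - 2 * \<beta> else s) *\<^sub>R e3"
  by (cases k; simp add: bilinear_of_table_axis)+

text \<open>\<open>\<Psi>\<close> keeps e1 in the plane. So a nonzero third coordinate of e1 e1
  detects \<open>H03\<close>, and a nonzero plane part of e1 e3 detects \<open>H02\<close>. For the
  parameter, e3 e3 gives t u^2 = s u in \<open>H01\<close> and \<open>H02\<close>; in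
  \<open>H03\<close>, e1 e1 gives t (p^2 + q^2) = s u with s, t = +-1, so t = s u. In both cases u =
  +-1, and u = -1 requires \<beta> = 0.\<close>

lemma h_conn_isomorphic_imp:
  assumes iso: "isomorphic_connections (g35 \<beta>) (h_conn \<beta> k s) (h_conn \<beta> k' t)"
    and s: "s \<in> h_params k" and t: "t \<in> h_params k'"
  shows "k = k' \<and> (t = s \<or> \<beta> = 0 \<and> t = - s)"
proof -
  obtain \<Psi> where \<Psi>: "lie_automorphism (g35 \<beta>) \<Psi>"
    and H: "\<And>X Y. h_conn \<beta> k' t (\<Psi> X) (\<Psi> Y) = \<Psi> (h_conn \<beta> k s X Y)"
    using iso unfolding isomorphic_connections_iff by blast
  obtain p q u where e: "\<Psi> e1 $ 1 = p" "\<Psi> e1 $ 2 = q" "\<Psi> e1 $ 3 = 0" "\<Psi> e3 $ 3 = u"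
    and pq: "p\<^sup>2 + q\<^sup>2 > 0" and u: "u = 1 \<or> \<beta> = 0 \<and> u = -1"
    using g35_automorphism_cases[OF \<Psi>] by metis
  have l: "linear \<Psi>" using \<Psi> by (simp add: lie_automorphism_def)
  have H': "h_conn \<beta> k' t (\<Psi> e1) (\<Psi> e1) $ 3 = (if k = H03 then s * u else 0)"
    "h_conn \<beta> k' t (\<Psi> e1) (\<Psi> e3) $ 1 = (if k = H02 then s * p else 0)"
    "h_conn \<beta> k' t (\<Psi> e1) (\<Psi> e3) $ 2 = (if k = H02 then s * q else 0)"
    "k \<noteq> H03 \<Longrightarrow> h_conn \<beta> k' t (\<Psi> e3) (\<Psi> e3) $ 3 = s * u"
    unfolding H h_conn_basis by (simp_all add: linear_scale[OF l] linear_0[OF l] e)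
  have pq': "p * p + q * q > 0" using pq by (simp add: power2_eq_square)
  have "k = k'"
    using H'(1-3) s t u pq' by (cases k; cases k') (auto simp: h_conn_simps e simp del: h_conn.simps)
  moreover have "t = s \<or> \<beta> = 0 \<and> t = - s"
  proof (cases "k' = H03")
    case True
    then have "t * (p * p + q * q) = s * u" using H'(1) \<open>k = k'\<close> by (simp add: h_conn_simps e del: h_conn.simps)
    then show ?thesis using s t u pq' True \<open>k = k'\<close> by (auto simp: add_eq_0_iff)
  next
    case False
    then have "t * u * u = s * u" using H'(4) \<open>k = k'\<close> by (cases k') (simp_all add: h_conn_simps e del: h_conn.simps)
    then show ?thesis using u by auto
  qed
  ultimately show ?thesis by blast
qed

text \<open>The uniqueness claim is split because \<open>h_conn_sign_flip\<close> identifies the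
  parameters s and -s for \<beta> = 0. The family is unique for every \<beta>, the parameter is
  unique for \<beta> > 0, and for \<beta> = 0 it is unique exactly up to sign.\<close>

theorem proposition8:
  fixes \<beta> :: real and nabla :: "real^3 \<Rightarrow> real^3 \<Rightarrow> real^3"
  assumes "\<beta> \<ge> 0"
    and "flat_lie_algebra (g35 \<beta>) nabla"
  shows "(\<exists>!k. \<exists>s\<in>h_params k. isomorphic_connections (g35 \<beta>) nabla (h_conn \<beta> k s)) \<and>
    (\<beta> > 0 \<longrightarrow>
      (\<exists>!(k, s). s \<in> h_params k \<and> isomorphic_connections (g35 \<beta>) nabla (h_conn \<beta> k s))) \<and>
    (\<beta> = 0 \<longrightarrow>
      (\<forall>k. \<forall>s\<in>h_params k. \<forall>t\<in>h_params k.
        isomorphic_connections (g35 \<beta>) nabla (h_conn \<beta> k s) \<longrightarrow>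
        (isomorphic_connections (g35 \<beta>) nabla (h_conn \<beta> k t) \<longleftrightarrow> t = s \<or> t = - s)))"
proof -
  let ?iso = "\<lambda>k s. isomorphic_connections (g35 \<beta>) nabla (h_conn \<beta> k s)"
  interpret flat_g35 \<beta> nabla using assms(2) by (simp add: flat_g35_def)
  obtain k s where ks: "s \<in> h_params k" "?iso k s"
    using classified unfolding h_classified_def by blast
  have uniq: "k = k' \<and> (t = s \<or> \<beta> = 0 \<and> t = - s)"
    if "s \<in> h_params k" "?iso k s" "t \<in> h_params k'" "?iso k' t" for k s k' t
    using h_conn_isomorphic_imp isomorphic_connections_trans isomorphic_connections_sym that by metis
  have "\<exists>!k. \<exists>s\<in>h_params k. ?iso k s"
    using ks uniq by blast
  moreover have "\<exists>!(k, s). s \<in> h_params k \<and> ?iso k s" if "\<beta> > 0"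
    by (rule ex1I[of _ "(k, s)"]) (use ks uniq that in \<open>auto split: prod.splits\<close>)
  moreover have "?iso k t \<longleftrightarrow> t = s \<or> t = - s"
    if "\<beta> = 0" "s \<in> h_params k" "t \<in> h_params k" "?iso k s" for k s t
    using that uniq[of s k t k] isomorphic_connections_trans[OF that(4)] h_conn_sign_flip[of k s] by metis
  ultimately show ?thesis by blast
qed

end
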